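(* If $G$ is a graph on $n\geq 3$ vertices such that $e(\overline{G}) \leq \lfloor n/2 \rfloor - 1$, then $q(G) = 2$.
   Context: All graphs are finite and simple; $\overline{G}$ denotes the complement of $G$ and $e(H)$ the number of edges of $H$. For a graph $G$ on $n$ vertices, $\mathcal{S}(G)$ is the set of real symmetric $n\times n$ matrices $A=[a_{ij}]$ with $a_{ij}\neq 0$ for $i\neq j$ if and only if $ij\in E(G)$ (diagonal unrestricted); $q(A)$ is the number of distinct eigenvalues of $A$ and $q(G)=\min\{q(A):A\in\mathcal{S}(G)\}$. *)

theory Defs
  imports "Jordan_Normal_Form.Spectral_Radius"
begin

text \<open>A graph on n vertices has vertex set \<open>{..<n}\<close>, so that vertices index the rows and columns
  of n by n matrices; an edge ij is the two-element set \<open>{i, j}\<close>.\<close>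

definition all_edges :: "nat \<Rightarrow> nat set set" where
  "all_edges n = {e. e \<subseteq> {..<n} \<and> card e = 2}"

definition simple_graph :: "nat \<Rightarrow> nat set set \<Rightarrow> bool" where
  "simple_graph n E \<longleftrightarrow> E \<subseteq> all_edges n"

definition complement_edges :: "nat \<Rightarrow> nat set set \<Rightarrow> nat set set" where
  "complement_edges n E = all_edges n - E"

definition sym_matrices :: "nat \<Rightarrow> nat set set \<Rightarrow> real mat set" where
  "sym_matrices n E = {A \<in> carrier_mat n n. transpose_mat A = A \<and>
     (\<forall>i<n. \<forall>j<n. i \<noteq> j \<longrightarrow> (A $$ (i, j) \<noteq> 0 \<longleftrightarrow> {i, j} \<in> E))}"

text \<open>The spectrum of a real matrix consists of its real eigenvalues; a real symmetric matrix has
  no others.\<close>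

definition num_eigenvalues :: "real mat \<Rightarrow> nat" where
  "num_eigenvalues A = card (spectrum A)"

definition q :: "nat \<Rightarrow> nat set set \<Rightarrow> nat" where
  "q n E = (LEAST k. \<exists>A \<in> sym_matrices n E. num_eigenvalues A = k)"

end

theory Submission
  imports Defs
begin

text \<open>Let \<open>H\<close> be the complement graph. If vectors \<open>u i\<close> in \<open>\<real>\<^sup>k\<close> satisfy \<open>\<Sum>i. u i (u i)\<^sup>T = c I\<close> and
  \<open>u i \<bottom> u j\<close> exactly for the edges \<open>ij\<close> of \<open>H\<close>, then their Gram matrix \<open>A\<close> has the pattern of \<open>G\<close> and
  satisfies \<open>A\<^sup>2 = c A\<close>, so it has at most two eigenvalues.

  Since \<open>H\<close> has few edges, it has many components, and counting shows that the number \<open>k\<close> of its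
  isolated vertices is at least the size of every component. So each nontrivial component is
  represented in \<open>\<real>\<^sup>k\<close> by linearly independent vectors with a prescribed, strictly diagonally
  dominant Gram matrix, and a generic reflection of each component destroys accidental orthogonality
  between components. If \<open>V\<close> has these vectors as rows and \<open>c\<close> is large, then \<open>c I - V\<^sup>T V = L\<^sup>T L\<close> with a
  square matrix \<open>L\<close>, and the rows of \<open>U L\<close>, for a generic reflection \<open>U\<close>, are the vectors of the \<open>k\<close>
  isolated vertices.

  Conversely, a symmetric matrix with a single real eigenvalue is scalar: after a shift its Schur
  form is strictly triangular, so the trace of its square, the sum of its squared entries,
  vanishes.\<close>

section \<open>Generic reflections\<close>

text \<open>Functions on the naturals stand for vectors of dimension \<open>k\<close>: only values
  below \<open>k\<close> enter, so no carrier conditions arise.\<close>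

definition ip :: "nat \<Rightarrow> (nat \<Rightarrow> real) \<Rightarrow> (nat \<Rightarrow> real) \<Rightarrow> real" where
  "ip k x y = (\<Sum>a<k. x a * y a)"

lemma ip_commute: "ip k x y = ip k y x"
  by (simp add: ip_def mult.commute)

lemma ip_diff_left: "ip k (\<lambda>a. s * x a - t * y a) z = s * ip k x z - t * ip k y z"
  by (simp add: ip_def sum_distrib_left sum_subtractf algebra_simps)

lemma ip_diff_right: "ip k z (\<lambda>a. s * x a - t * y a) = s * ip k z x - t * ip k z y"
  by (simp add: ip_def sum_distrib_left sum_subtractf algebra_simps)

lemma ip_add_left: "ip k (\<lambda>a. x a + y a) z = ip k x z + ip k y z"
  by (simp add: ip_def sum.distrib algebra_simps)

lemma ip_add_right: "ip k z (\<lambda>a. x a + y a) = ip k z x + ip k z y"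
  by (simp add: ip_def sum.distrib algebra_simps)

lemma ip_self_nonneg: "ip k x x \<ge> 0"
  by (simp add: ip_def sum_nonneg)

lemma ip_self_eq_0_iff: "ip k x x = 0 \<longleftrightarrow> (\<forall>a<k. x a = 0)"
  by (auto simp: ip_def sum_nonneg_eq_0_iff)

lemma ip_unit_right: "j < k \<Longrightarrow> ip k x (\<lambda>a. of_bool (a = j)) = x j"
  by (simp add: ip_def of_bool_def if_distrib[of "\<lambda>y. _ * y"] cong: if_cong)

text \<open>If finitely many such functions each have a non-zero, then so does their product: join a common
  non-zero of all but one to a non-zero of the last one by a line.\<close>

definition line_poly :: "((nat \<Rightarrow> real) \<Rightarrow> real) \<Rightarrow> bool" where
  "line_poly f \<longleftrightarrow> (\<forall>x d. \<exists>p. \<forall>t. f (\<lambda>a. x a + t * d a) = poly p t)"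

lemma line_poly_const: "line_poly (\<lambda>w. c)"
  unfolding line_poly_def by (intro allI exI[of _ "[:c:]"]) simp

lemma line_poly_coord: "line_poly (\<lambda>w. w a)"
  unfolding line_poly_def
proof (intro allI)
  fix x d :: "nat \<Rightarrow> real"
  show "\<exists>p. \<forall>t. x a + t * d a = poly p t"
    by (rule exI[of _ "[:x a, d a:]"]) simp
qed

lemma line_poly_add: "line_poly f \<Longrightarrow> line_poly g \<Longrightarrow> line_poly (\<lambda>w. f w + g w)"
  unfolding line_poly_def by (metis poly_add)

lemma line_poly_diff: "line_poly f \<Longrightarrow> line_poly g \<Longrightarrow> line_poly (\<lambda>w. f w - g w)"
  unfolding line_poly_def by (metis poly_diff)

lemma line_poly_mult: "line_poly f \<Longrightarrow> line_poly g \<Longrightarrow> line_poly (\<lambda>w. f w * g w)"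
  unfolding line_poly_def by (metis poly_mult)

lemma line_poly_sum: "(\<And>i. i \<in> I \<Longrightarrow> line_poly (f i)) \<Longrightarrow> line_poly (\<lambda>w. \<Sum>i\<in>I. f i w)"
  by (induction I rule: infinite_finite_induct) (auto intro: line_poly_const line_poly_add)

lemmas line_poly_intros =
  line_poly_const line_poly_coord line_poly_add line_poly_diff line_poly_mult line_poly_sum

lemma line_poly_ip:
  assumes "\<And>a. line_poly (\<lambda>w. f w a)" "\<And>a. line_poly (\<lambda>w. g w a)"
  shows "line_poly (\<lambda>w. ip k (f w) (g w))"
  unfolding ip_def by (intro line_poly_intros assms)

lemma ex_common_nonzero:
  assumes "finite F" "\<And>f. f \<in> F \<Longrightarrow> line_poly f" "\<And>f. f \<in> F \<Longrightarrow> \<exists>w. f w \<noteq> 0"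
  shows "\<exists>w. \<forall>f\<in>F. f w \<noteq> 0"
  using assms
proof (induction F)
  case (insert g F)
  have "\<exists>w. \<forall>f\<in>F. f w \<noteq> 0" by (rule insert.IH) (simp_all add: insert.prems)
  then obtain w0 where w0: "\<forall>f\<in>F. f w0 \<noteq> 0" by blast
  have "\<exists>w. g w \<noteq> 0" by (rule insert.prems(2)) simp
  then obtain w1 where w1: "g w1 \<noteq> 0" by blast
  define pt where "pt t = (\<lambda>a. w0 a + t * (w1 a - w0 a))" for t :: real
  \<comment> \<open>On the line \<open>pt\<close> each function is a polynomial in \<open>t\<close>
    that is non-zero at 0 (members of \<open>F\<close>) or at 1 (\<open>g\<close>), so it excludes
    only finitely many \<open>t\<close>.\<close>
  have "finite {t. f (pt t) = 0}" if f: "f \<in> insert g F" for f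
  proof -
    have "line_poly f" using insert.prems f by blast
    then obtain p where p: "\<And>t. f (pt t) = poly p t"
      unfolding line_poly_def pt_def by (metis (no_types))
    have "pt 0 = w0" "pt 1 = w1" by (auto simp: pt_def)
    then have "p \<noteq> 0" using w0 w1 f p by (metis insertE poly_0)
    then show ?thesis by (simp add: p poly_roots_finite)
  qed
  then have "finite (\<Union>f\<in>insert g F. {t. f (pt t) = 0})"
    using insert.hyps by blast
  then obtain t where "t \<notin> (\<Union>f\<in>insert g F. {t. f (pt t) = 0})"
    using ex_new_if_finite[OF infinite_UNIV_char_0] by blast
  then show ?case by blast
qed auto

text \<open>The Householder reflection along \<open>w\<close>, scaled by \<open>ip k w w\<close> so that it is polynomial in \<open>w\<close>.\<close>

definition reflect :: "nat \<Rightarrow> (nat \<Rightarrow> real) \<Rightarrow> (nat \<Rightarrow> real) \<Rightarrow> nat \<Rightarrow> real" where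
  "reflect k w x = (\<lambda>a. ip k w w * x a - 2 * ip k w x * w a)"

lemma ip_reflect: "ip k x (reflect k w y) = ip k w w * ip k x y - 2 * ip k w x * ip k w y"
  unfolding reflect_def ip_diff_right by (simp add: ip_commute)

text \<open>A reflection is an isometry; its scaling factor enters once for each argument.\<close>

lemma ip_reflect_reflect: "ip k (reflect k w x) (reflect k w y) = (ip k w w)\<^sup>2 * ip k x y"
  unfolding ip_reflect
  unfolding reflect_def ip_diff_left ip_diff_right by (simp add: ip_commute power2_eq_square algebra_simps)

lemma line_poly_reflect: "line_poly (\<lambda>w. reflect k w x a)"
  unfolding reflect_def by (intro line_poly_intros line_poly_ip)

text \<open>Supplies the individual non-zeros that \<open>ex_common_nonzero\<close> asks for.
  Reflecting along \<open>x\<close> only negates the inner product up to scaling, which helps unless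
  it is 0; in that case \<open>x + y\<close> has non-zero inner products with both vectors.\<close>

lemma ex_ip_reflect_nonzero:
  assumes "ip k x x \<noteq> 0" "ip k y y \<noteq> 0"
  shows "\<exists>w. ip k x (reflect k w y) \<noteq> 0"
proof (cases "ip k x y = 0")
  case True
  have "ip k x (reflect k (\<lambda>a. x a + y a) y) = - 2 * ip k x x * ip k y y"
    unfolding ip_reflect using True by (simp add: ip_add_left ip_commute)
  then show ?thesis using assms by (intro exI[of _ "\<lambda>a. x a + y a"]) simp
next
  case False
  have "ip k x (reflect k x y) = - ip k x x * ip k x y"
    unfolding ip_reflect by simp
  then show ?thesis using assms False by (intro exI[of _ x]) simp
qed

definition unit :: "nat \<Rightarrow> nat \<Rightarrow> real" where
  "unit i = (\<lambda>a. of_bool (a = i))"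

lemma ip_unit: "j < k \<Longrightarrow> ip k x (unit j) = x j" "j < k \<Longrightarrow> ip k (unit j) x = x j"
  unfolding unit_def by (simp_all add: ip_unit_right ip_commute)

section \<open>Cholesky factorisation\<close>

text \<open>Induction splits off the last row and column: the Schur complement \<open>B'\<close> of
  the last diagonal entry is again positive definite. The factor is square, which later makes the
  number of new vectors equal to the dimension.\<close>

lemma cholesky:
  fixes B :: "nat \<Rightarrow> nat \<Rightarrow> real"
  assumes "\<And>i j. i < n \<Longrightarrow> j < n \<Longrightarrow> B i j = B j i"
    and "\<And>x. \<exists>i<n. x i \<noteq> 0 \<Longrightarrow> (\<Sum>i<n. \<Sum>j<n. x i * x j * B i j) > 0"
  shows "\<exists>L. \<forall>i<n. \<forall>j<n. B i j = (\<Sum>l<n. L l i * L l j)"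
  using assms
proof (induction n arbitrary: B)
  case (Suc n)
  define d where "d = B n n"
  have d: "d > 0"
  proof -
    have "0 < (\<Sum>i<Suc n. \<Sum>j<Suc n. unit n i * unit n j * B i j)"
      by (rule Suc.prems(2)) (auto simp: unit_def)
    moreover have "unit n i = 0" if "i < n" for i using that by (simp add: unit_def)
    ultimately show ?thesis by (simp add: d_def unit_def)
  qed
  define B' where "B' i j = B i j - B n i * B n j / d" for i j
  have "\<exists>L. \<forall>i<n. \<forall>j<n. B' i j = (\<Sum>l<n. L l i * L l j)"
  proof (rule Suc.IH)
    show "B' i j = B' j i" if "i < n" "j < n" for i j
      using that Suc.prems(1)[of i j] by (simp add: B'_def mult.commute)
    show "(\<Sum>i<n. \<Sum>j<n. x i * x j * B' i j) > 0" if "\<exists>i<n. x i \<noteq> 0" for x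
    proof -
      define s where "s = (\<Sum>i<n. x i * B n i)"
      \<comment> \<open>This last coordinate minimises the form for given \<open>x\<close>;
        completing the square leaves exactly the form of \<open>B'\<close>.\<close>
      define y where "y = x(n := - s / d)"
      have "0 < (\<Sum>i<Suc n. \<Sum>j<Suc n. y i * y j * B i j)"
      proof (rule Suc.prems(2))
        show "\<exists>i<Suc n. y i \<noteq> 0"
          using that unfolding y_def by (metis fun_upd_other less_SucI less_irrefl)
      qed
      also have "\<dots> = (\<Sum>i<n. \<Sum>j<n. x i * x j * B i j) + (\<Sum>i<n. x i * (- s / d) * B i n)
          + (\<Sum>j<n. (- s / d) * x j * B n j) + (- s / d) * (- s / d) * d"
        by (simp add: y_def sum.distrib d_def sum_negf sum_subtractf)
      also have "(\<Sum>i<n. x i * (- s / d) * B i n) = (- s / d) * s"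
        unfolding s_def sum_distrib_left using Suc.prems(1)
        by (intro sum.cong) (auto simp: mult_ac)
      also have "(\<Sum>j<n. (- s / d) * x j * B n j) = (- s / d) * s"
        unfolding s_def sum_distrib_left by (intro sum.cong) (auto simp: mult_ac)
      also have "(\<Sum>i<n. \<Sum>j<n. x i * x j * B i j) + (- s / d) * s + (- s / d) * s + (- s / d) * (- s / d) * d
          = (\<Sum>i<n. \<Sum>j<n. x i * x j * B i j) - s * s / d"
        using d by (simp add: field_simps)
      also have "s * s / d = (\<Sum>i<n. \<Sum>j<n. x i * x j * (B n i * B n j / d))"
        unfolding s_def sum_product sum_divide_distrib by (simp add: mult_ac)
      finally show ?thesis
        unfolding B'_def right_diff_distrib sum_subtractf by simp
    qed
  qed
  then obtain L where L: "\<And>i j. i < n \<Longrightarrow> j < n \<Longrightarrow> B' i j = (\<Sum>l<n. L l i * L l j)" by blast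
  \<comment> \<open>The factor of \<open>B'\<close> is bordered by a last row that accounts for the
    subtracted rank-one term; the last column is 0 above that row.\<close>
  define L' where "L' l i = (if l = n then B n i / sqrt d else if i = n then 0 else L l i)" for l i
  have sq: "B n i / sqrt d * (B n j / sqrt d) = B n i * B n j / d" for i j
    using d by simp
  have "B i j = (\<Sum>l<Suc n. L' l i * L' l j)" if ij: "i < Suc n" "j < Suc n" for i j
  proof -
    have "(\<Sum>l<n. L' l i * L' l j) = B i j - B n i * B n j / d"
    proof (cases "i = n \<or> j = n")
      case True
      then have "(\<Sum>l<n. L' l i * L' l j) = 0" by (auto simp: L'_def intro!: sum.neutral)
      moreover have "B i j = B n i * B n j / d"
        using True d Suc.prems(1)[of i j] ij by (auto simp: d_def)
      ultimately show ?thesis by simp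
    next
      case False
      then show ?thesis using L[of i j] ij by (simp add: L'_def B'_def)
    qed
    moreover have "L' n i * L' n j = B n i * B n j / d"
      using sq by (simp add: L'_def)
    ultimately show ?thesis by simp
  qed
  then show ?case by blast
qed simp

text \<open>Bounding each product of two coordinates by the mean of their squares shows that the
  part of \<open>M\<close> is at least \<open>- k * \<beta>\<close> times the squared length of
  \<open>x\<close>, which the diagonal part outweighs.\<close>

lemma perturbed_identity_pos:
  fixes M :: "nat \<Rightarrow> nat \<Rightarrow> real"
  assumes "\<And>i j. i < k \<Longrightarrow> j < k \<Longrightarrow> \<bar>M i j\<bar> \<le> \<beta>" "c > k * \<beta>" "\<exists>i<k. x i \<noteq> 0"
  shows "(\<Sum>i<k. \<Sum>j<k. x i * x j * (of_bool (i = j) * c + M i j)) > 0"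
proof -
  have 1: "(\<Sum>i<k. \<Sum>j<k. x i * x j * (of_bool (i = j) * c)) = c * ip k x x"
    by (simp add: ip_def sum_distrib_left of_bool_def if_distrib if_distribR mult_ac cong: if_cong)
  have b: "x i * x j * M i j \<ge> - (((x i)\<^sup>2 + (x j)\<^sup>2) / 2 * \<beta>)" if "i < k" "j < k" for i j
  proof -
    have "\<bar>x i * x j * M i j\<bar> = \<bar>x i * x j\<bar> * \<bar>M i j\<bar>" by (simp add: abs_mult)
    also have "\<dots> \<le> ((x i)\<^sup>2 + (x j)\<^sup>2) / 2 * \<beta>"
    proof (rule mult_mono)
      have "(\<bar>x i\<bar> - \<bar>x j\<bar>)\<^sup>2 \<ge> 0" by simp
      then show "\<bar>x i * x j\<bar> \<le> ((x i)\<^sup>2 + (x j)\<^sup>2) / 2"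
        by (simp add: power2_diff abs_mult)
    qed (use assms(1) that in auto)
    finally show ?thesis by linarith
  qed
  have "(\<Sum>i<k. \<Sum>j<k. x i * x j * M i j) \<ge> (\<Sum>i<k. \<Sum>j<k. - (((x i)\<^sup>2 + (x j)\<^sup>2) / 2 * \<beta>))"
    using b by (intro sum_mono) auto
  also have "(\<Sum>i<k. \<Sum>j<k. - (((x i)\<^sup>2 + (x j)\<^sup>2) / 2 * \<beta>)) = - (k * \<beta> * ip k x x)"
  proof -
    have "(\<Sum>i<k. \<Sum>j<k. ((x i)\<^sup>2 + (x j)\<^sup>2)) = 2 * k * ip k x x"
      by (simp add: sum.distrib ip_def power2_eq_square flip: sum_distrib_left)
    then have "(\<Sum>i<k. \<Sum>j<k. ((x i)\<^sup>2 + (x j)\<^sup>2)) * (- \<beta> / 2) = - (k * \<beta> * ip k x x)" by simp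
    then show ?thesis unfolding sum_distrib_right by (simp add: mult_ac)
  qed
  finally have "(\<Sum>i<k. \<Sum>j<k. x i * x j * M i j) \<ge> - (k * \<beta> * ip k x x)" .
  moreover have "k * \<beta> * ip k x x < c * ip k x x"
    using assms(2,3) ip_self_nonneg[of k x] ip_self_eq_0_iff[of k x]
    by (intro mult_strict_right_mono) (auto simp: order_less_le)
  ultimately show ?thesis
    using 1 by (simp add: distrib_left sum.distrib)
qed

section \<open>Vectors with prescribed orthogonalities\<close>

text \<open>Induction over the labels. A class of at most \<open>k\<close> elements gets vectors
  with a prescribed positive definite Gram matrix; a common reflection keeps the orthogonalities
  inside the class and destroys those with the classes placed before.\<close>

lemma ex_faithful_vectors:
  assumes "finite \<Lambda>" and N: "finite N" and k: "k > 0"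
    and size: "\<And>l. card {i \<in> N. f i = l} \<le> k"
    and sym: "\<And>i j. H i j \<longleftrightarrow> H j i" and irrefl: "\<And>i. \<not> H i i"
    and label: "\<And>i j. i \<in> N \<Longrightarrow> j \<in> N \<Longrightarrow> H i j \<Longrightarrow> f i = f j"
  shows "\<exists>v. \<forall>i\<in>{i \<in> N. f i \<in> \<Lambda>}. \<forall>j\<in>{i \<in> N. f i \<in> \<Lambda>}. ip k (v i) (v j) = 0 \<longleftrightarrow> H i j"
  using \<open>finite \<Lambda>\<close>
proof (induction \<Lambda>)
  case (insert l \<Lambda>)
  define D where "D = {i \<in> N. f i \<in> \<Lambda>}"
  define C where "C = {i \<in> N. f i = l}"
  have fin: "finite C" "finite D" using N by (auto simp: C_def D_def)
  obtain v where v: "\<And>i j. i \<in> D \<Longrightarrow> j \<in> D \<Longrightarrow> ip k (v i) (v j) = 0 \<longleftrightarrow> H i j"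
    using insert.IH unfolding D_def by blast
  obtain g where g: "bij_betw g C {..<card C}"
    using ex_bij_betw_finite_nat[OF fin(1)] by (auto simp: atLeast0LessThan)
  have gk: "g i < k" if "i \<in> C" for i
  proof -
    have "g i < card C" using g that by (auto simp: bij_betw_def)
    then show ?thesis using size[of l] by (simp add: C_def)
  qed
  \<comment> \<open>The off-diagonal part of the Gram matrix, with entries 0 and 1, so that a
    diagonal of \<open>k + 1\<close> dominates. Indices from \<open>card C\<close> on, where
    \<open>inv_into\<close> is unspecified, merely pad the matrix to size \<open>k\<close>.\<close>
  define G :: "nat \<Rightarrow> nat \<Rightarrow> real"
    where "G a b = of_bool (a \<noteq> b \<and> \<not> H (inv_into C g a) (inv_into C g b))" for a b :: nat
  have "\<exists>L. \<forall>a<k. \<forall>b<k. of_bool (a = b) * (real k + 1) + G a b = (\<Sum>p<k. L p a * L p b)"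
  proof (rule cholesky)
    show "of_bool (a = b) * (real k + 1) + G a b = of_bool (b = a) * (real k + 1) + G b a" for a b
      using sym by (auto simp: G_def)
    show "(\<Sum>a<k. \<Sum>b<k. x a * x b * (of_bool (a = b) * (real k + 1) + G a b)) > 0"
      if "\<exists>a<k. x a \<noteq> 0" for x
      by (rule perturbed_identity_pos[of _ _ 1]) (use that in \<open>auto simp: G_def\<close>)
  qed
  then obtain L where L: "\<And>a b. a < k \<Longrightarrow> b < k \<Longrightarrow>
      of_bool (a = b) * (real k + 1) + G a b = (\<Sum>p<k. L p a * L p b)" by blast
  define x where "x i = (\<lambda>p. L p (g i))" for i
  have x: "ip k (x i) (x j) = 0 \<longleftrightarrow> H i j" if "i \<in> C" "j \<in> C" for i j
  proof -
    have "ip k (x i) (x j) = of_bool (g i = g j) * (real k + 1) + G (g i) (g j)"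
      unfolding ip_def x_def using L gk that by simp
    moreover have "g i = g j \<longleftrightarrow> i = j"
      using g that by (auto simp: bij_betw_def inj_on_def)
    moreover have "inv_into C g (g i) = i" "inv_into C g (g j) = j"
      using g that by (auto simp: bij_betw_def)
    ultimately show ?thesis using irrefl by (auto simp: G_def)
  qed
  \<comment> \<open>The first function keeps the scaled reflection from degenerating to 0.\<close>
  define F where "F = insert (\<lambda>w. ip k w w) ((\<lambda>(i, j) w. ip k (v i) (reflect k w (x j))) ` (D \<times> C))"
  have "\<exists>w. \<forall>f\<in>F. f w \<noteq> 0"
  proof (rule ex_common_nonzero)
    show "finite F" using fin by (simp add: F_def)
    show "line_poly f" if "f \<in> F" for f
      using that unfolding F_def by (auto intro!: line_poly_ip line_poly_reflect line_poly_const line_poly_coord)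
    show "\<exists>w. f w \<noteq> 0" if "f \<in> F" for f
    proof -
      from that consider "f = (\<lambda>w. ip k w w)"
        | i j where "i \<in> D" "j \<in> C" "f = (\<lambda>w. ip k (v i) (reflect k w (x j)))"
        unfolding F_def by auto
      then show ?thesis
      proof cases
        case 1
        then show ?thesis using k ip_unit(1)[of 0 k "unit 0"] by (intro exI[of _ "unit 0"]) (simp add: unit_def)
      next
        case 2
        then show ?thesis using ex_ip_reflect_nonzero v x irrefl by simp
      qed
    qed
  qed
  then obtain w where w: "\<And>f. f \<in> F \<Longrightarrow> f w \<noteq> 0" by blast
  have w1: "ip k w w \<noteq> 0" using w[of "\<lambda>w. ip k w w"] by (simp add: F_def)
  have w2: "ip k (v i) (reflect k w (x j)) \<noteq> 0" if "i \<in> D" "j \<in> C" for i j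
    by (rule w[of "\<lambda>w. ip k (v i) (reflect k w (x j))"]) (use that in \<open>auto simp: F_def\<close>)
  define u where "u i = (if f i = l then reflect k w (x i) else v i)" for i
  have uC: "u i = reflect k w (x i)" if "i \<in> C" for i using that by (simp add: u_def C_def)
  have uD: "u i = v i" if "i \<in> D" for i using that insert.hyps by (auto simp: u_def D_def)
  have cross: "\<not> H i j" if "i \<in> D" "j \<in> C" for i j
    using that insert.hyps label[of i j] by (auto simp: C_def D_def)
  have "ip k (u i) (u j) = 0 \<longleftrightarrow> H i j" if ij: "i \<in> C \<union> D" "j \<in> C \<union> D" for i j
  proof -
    consider "i \<in> C" "j \<in> C" | "i \<in> D" "j \<in> D" | "i \<in> D" "j \<in> C" | "i \<in> C" "j \<in> D"
      using ij by blast
    then show ?thesis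
    proof cases
      case 1 then show ?thesis using x w1 by (simp add: uC ip_reflect_reflect)
    next
      case 2 then show ?thesis using v by (simp add: uD)
    next
      case 3 then show ?thesis using w2 cross by (simp add: uC uD)
    next
      case 4 then show ?thesis using w2 cross[of j i] sym[of i j] by (simp add: uC uD ip_commute[of k "reflect _ _ _"])
    qed
  qed
  moreover have "{i \<in> N. f i \<in> insert l \<Lambda>} = C \<union> D" by (auto simp: C_def D_def)
  ultimately show ?case by (intro exI[of _ u]) simp
qed simp

section \<open>Completion to a tight frame\<close>

definition bilin :: "nat \<Rightarrow> (nat \<Rightarrow> nat \<Rightarrow> real) \<Rightarrow> (nat \<Rightarrow> real) \<Rightarrow> (nat \<Rightarrow> real) \<Rightarrow> real" where
  "bilin k S x y = (\<Sum>a<k. \<Sum>b<k. x a * S a b * y b)"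

lemma sum_rotate: "(\<Sum>b\<in>B. \<Sum>p\<in>P. \<Sum>q\<in>Q. f b p q) = (\<Sum>p\<in>P. \<Sum>q\<in>Q. \<Sum>b\<in>B. f b p q)"
  by (subst sum.swap, rule sum.cong[OF refl], rule sum.swap)

lemma bilin_diff_left: "bilin k S (\<lambda>a. s * x a - t * y a) z = s * bilin k S x z - t * bilin k S y z"
  by (simp add: bilin_def sum_distrib_left sum_subtractf algebra_simps)

lemma bilin_diff_right: "bilin k S z (\<lambda>a. s * x a - t * y a) = s * bilin k S z x - t * bilin k S z y"
  by (simp add: bilin_def sum_distrib_left sum_subtractf algebra_simps)

lemma bilin_add_left: "bilin k S (\<lambda>a. x a + y a) z = bilin k S x z + bilin k S y z"
  by (simp add: bilin_def sum.distrib algebra_simps)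

lemma bilin_add_right: "bilin k S z (\<lambda>a. x a + y a) = bilin k S z x + bilin k S z y"
  by (simp add: bilin_def sum.distrib algebra_simps)

lemma sum_unit: "j < k \<Longrightarrow> (\<Sum>b<k. f b * unit j b) = f j" "j < k \<Longrightarrow> (\<Sum>b<k. unit j b * f b) = f j"
  by (simp_all add: unit_def of_bool_def if_distrib if_distribR cong: if_cong)

lemma bilin_unit: "i < k \<Longrightarrow> j < k \<Longrightarrow> bilin k S (unit i) (unit j) = S i j"
  by (simp add: bilin_def sum_unit mult.assoc flip: sum_distrib_left)

lemma bilin_reflect_reflect:
  "bilin k S (reflect k w x) (reflect k w y) = (ip k w w)\<^sup>2 * bilin k S x y
     - 2 * ip k w w * (ip k w y * bilin k S x w + ip k w x * bilin k S w y)
     + 4 * ip k w x * ip k w y * bilin k S w w"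
  unfolding reflect_def bilin_diff_left bilin_diff_right
  by (simp add: power2_eq_square algebra_simps)

lemma line_poly_bilin:
  assumes "\<And>a. line_poly (\<lambda>w. f w a)" "\<And>a. line_poly (\<lambda>w. g w a)"
  shows "line_poly (\<lambda>w. bilin k S (f w) (g w))"
  unfolding bilin_def by (intro line_poly_intros assms)

text \<open>Used in contraposed form: if \<open>S\<close> is not scalar, some reflection makes the
  entry at \<open>i\<close>, \<open>j\<close> non-zero. Reflecting along small combinations of unit
  vectors isolates the entries of \<open>S\<close> one after another.\<close>

lemma scalar_if_reflect_entry_0:
  assumes sym: "\<And>a b. a < k \<Longrightarrow> b < k \<Longrightarrow> S a b = S b a"
    and ij: "i < k" "j < k" "i \<noteq> j"
    and zero: "\<And>w. bilin k S (reflect k w (unit i)) (reflect k w (unit j)) = 0"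
  shows "\<exists>d. \<forall>a<k. \<forall>b<k. S a b = of_bool (a = b) * d"
proof -
  have u: "unit a a = 1" "a \<noteq> b \<Longrightarrow> unit a b = 0" for a b by (simp_all add: unit_def)
  note ev = bilin_unit ip_unit u
  note exp = bilin_reflect_reflect bilin_add_left bilin_add_right ip_add_left ip_add_right
  have Sij: "S i j = 0"
    using zero[of "unit i"] ij sym[of i j] unfolding exp by (simp add: ev)
  have Sji: "S j i = 0" using Sij sym ij by simp
  \<comment> \<open>The weight 2 on \<open>j\<close> matters: with equal weights the reflection
    merely swaps the two unit vectors up to a factor, and the equation says nothing new.\<close>
  have Sjj: "S j j = S i i"
    using zero[of "\<lambda>a. unit i a + (unit j a + unit j a)"] ij Sij Sji
    unfolding exp by (simp add: ev)
  have Sil: "S i l = 0" if "l < k" "l \<noteq> i" "l \<noteq> j" for l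
    using zero[of "\<lambda>a. unit j a + unit l a"] ij that Sij Sji sym[of i l] unfolding exp by (simp add: ev)
  have Sjl: "S j l = 0" if "l < k" "l \<noteq> i" "l \<noteq> j" for l
    using zero[of "\<lambda>a. unit i a + unit l a"] ij that Sij Sji sym[of j l] unfolding exp by (simp add: ev)
  have Sll: "S l l = S i i" if "l < k" "l \<noteq> i" "l \<noteq> j" for l
    using zero[of "\<lambda>a. unit i a + (unit j a + unit l a)"] ij that Sij Sji Sjj Sil[of l] Sjl[of l]
      sym[of i l] sym[of j l] unfolding exp by (simp add: ev)
  have Slm: "S l m = 0" if "l < k" "l \<noteq> i" "l \<noteq> j" "m < k" "m \<noteq> i" "m \<noteq> j" "l \<noteq> m" for l m
    using zero[of "\<lambda>a. unit i a + (unit j a + (unit l a + unit m a))"] ij that Sij Sji Sjj Sil[of l] Sjl[of l]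
      sym[of i l] sym[of j l] Sil[of m] Sjl[of m] sym[of i m] sym[of j m] sym[of l m] Sll[of l] Sll[of m]
    unfolding exp by (simp add: ev)
  show ?thesis
  proof (intro exI[of _ "S i i"] allI impI)
    fix a b assume ab: "a < k" "b < k"
    show "S a b = of_bool (a = b) * S i i"
    proof (cases "a = b")
      case True
      then show ?thesis using Sjj Sll[of a] ab by (cases "a = i"; cases "a = j") simp_all
    next
      case False
      consider "a = i" "b = j" | "a = j" "b = i" | "a = i" "b \<noteq> j" | "a = j" "b \<noteq> i"
        | "b = i" "a \<noteq> j" | "b = j" "a \<noteq> i" | "a \<noteq> i" "a \<noteq> j" "b \<noteq> i" "b \<noteq> j"
        by metis
      then have "S a b = 0"
      proof cases
        case 3 then show ?thesis using Sil[of b] ab False by simp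
      next
        case 4 then show ?thesis using Sjl[of b] ab False by simp
      next
        case 5 then show ?thesis using Sil[of a] sym[of a b] ab False by simp
      next
        case 6 then show ?thesis using Sjl[of a] sym[of a b] ab False by simp
      next
        case 7 then show ?thesis using Slm[of a b] ab False by simp
      qed (simp_all add: Sij Sji)
      then show ?thesis using False by simp
    qed
  qed
qed

definition frame_op :: "nat set \<Rightarrow> (nat \<Rightarrow> nat \<Rightarrow> real) \<Rightarrow> nat \<Rightarrow> nat \<Rightarrow> real" where
  "frame_op N v a b = (\<Sum>i\<in>N. v i a * v i b)"

definition scalar_on :: "nat \<Rightarrow> (nat \<Rightarrow> nat \<Rightarrow> real) \<Rightarrow> bool" where
  "scalar_on k S \<longleftrightarrow> (\<exists>d. \<forall>a<k. \<forall>b<k. S a b = of_bool (a = b) * d)"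

text \<open>Doubling the vector \<open>v i\<close> changes the frame operator by a rank-one matrix, which is not scalar
  for \<open>k \<ge> 2\<close>.\<close>

lemma ex_rescaled_frame_not_scalar:
  assumes N: "finite N" "i \<in> N" and k: "k \<ge> 2" and v: "ip k (v i) (v i) \<noteq> 0"
  shows "\<exists>s. (\<forall>j. s j \<noteq> 0) \<and> \<not> scalar_on k (frame_op N (\<lambda>j a. s j * v j a))"
proof (rule ccontr)
  assume neg: "\<not> ?thesis"
  define s where "s = (\<lambda>j. if j = i then 2 else 1 :: real)"
  have "scalar_on k (frame_op N (\<lambda>j a. 1 * v j a))" "scalar_on k (frame_op N (\<lambda>j a. s j * v j a))"
  proof -
    have "scalar_on k (frame_op N (\<lambda>j a. s j * v j a))" if "\<And>j. s j \<noteq> 0" for s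
      using neg that by blast
    from this[of "\<lambda>_. 1"] this[of s] show "scalar_on k (frame_op N (\<lambda>j a. 1 * v j a))"
      "scalar_on k (frame_op N (\<lambda>j a. s j * v j a))"
      by (simp_all add: s_def)
  qed
  note sc = this[unfolded scalar_on_def]
  obtain d where d: "\<And>a b. a < k \<Longrightarrow> b < k \<Longrightarrow> frame_op N v a b = of_bool (a = b) * d"
    using sc(1) unfolding mult_1 by blast
  obtain e where e: "\<And>a b. a < k \<Longrightarrow> b < k \<Longrightarrow> frame_op N (\<lambda>j a. s j * v j a) a b = of_bool (a = b) * e"
    using sc(2) by blast
  have "frame_op N (\<lambda>j a. s j * v j a) a b = frame_op N v a b + 3 * (v i a * v i b)" for a b
    using N by (simp add: frame_op_def sum.remove s_def)
  then have 3: "3 * (v i a * v i b) = of_bool (a = b) * (e - d)" if "a < k" "b < k" for a b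
    using d[OF that] e[OF that] by (simp add: algebra_simps)
  \<comment> \<open>One of two coordinates with equal squares vanishes, hence both do and
    \<open>e = d\<close>. Two coordinates exist as \<open>k\<close> is at least 2.\<close>
  have "v i 0 * v i 1 = 0" "v i 0 * v i 0 = (e - d) / 3" "v i 1 * v i 1 = (e - d) / 3"
    using 3[of 0 1] 3[of 0 0] 3[of 1 1] k by auto
  then have "e = d" by (metis diff_eq_diff_eq diff_self divide_eq_0_iff mult_eq_0_iff zero_neq_numeral right_minus_eq)
  then have "v i a = 0" if "a < k" for a using 3[OF that that] by simp
  then show False using v by (simp add: ip_def)
qed

text \<open>Exactly \<open>k\<close> new vectors suffice, because the defect of the old frame
  operator from a large scalar matrix is positive definite of size \<open>k\<close> and so has a
  square factor \<open>L\<close>.\<close>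

lemma tight_frame_extension:
  assumes N: "finite N" "N \<noteq> {}" and R: "finite R" "N \<inter> R = {}" and k: "k = card R" "k \<ge> 2"
    and v: "\<And>i. i \<in> N \<Longrightarrow> ip k (v i) (v i) \<noteq> 0"
  shows "\<exists>u c. (\<forall>a<k. \<forall>b<k. frame_op (N \<union> R) u a b = of_bool (a = b) * c)
    \<and> (\<forall>i\<in>N. \<forall>j\<in>N. ip k (u i) (u j) = 0 \<longleftrightarrow> ip k (v i) (v j) = 0)
    \<and> (\<forall>i\<in>N \<union> R. \<forall>j\<in>R. i \<noteq> j \<longrightarrow> ip k (u i) (u j) \<noteq> 0)"
proof -
  obtain i0 where "i0 \<in> N" using N by blast
  \<comment> \<open>Rescaling preserves the orthogonalities among the old vectors. A non-scalar
    frame operator is needed below to make the new vectors pairwise non-orthogonal.\<close>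
  then obtain s where s: "\<And>j. s j \<noteq> 0" and ns: "\<not> scalar_on k (frame_op N (\<lambda>j a. s j * v j a))"
    using ex_rescaled_frame_not_scalar[OF N(1) _ k(2)] v by metis
  define x where "x j a = s j * v j a" for j a
  have ip_x: "ip k (x i) (x j) = s i * s j * ip k (v i) (v j)" for i j
    by (simp add: ip_def x_def sum_distrib_left mult_ac)
  define T where "T = frame_op N x"
  have nsT: "\<not> scalar_on k T" using ns by (simp add: T_def x_def[abs_def])
  have symT: "T a b = T b a" for a b by (simp add: T_def frame_op_def mult.commute)
  define \<beta> where "\<beta> = (\<Sum>a<k. \<Sum>b<k. \<bar>T a b\<bar>)"
  define c where "c = k * \<beta> + 1"
  define M where "M a b = of_bool (a = b) * c + - T a b" for a b
  have T_le: "\<bar>- T a b\<bar> \<le> \<beta>" if "a < k" "b < k" for a b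
  proof -
    have "\<bar>T a b\<bar> \<le> (\<Sum>b<k. \<bar>T a b\<bar>)" using that by (intro member_le_sum) auto
    also have "\<dots> \<le> \<beta>" unfolding \<beta>_def using that
      by (intro member_le_sum[of a _ "\<lambda>a. \<Sum>b<k. \<bar>T a b\<bar>"]) (auto intro: sum_nonneg)
    finally show ?thesis by simp
  qed
  have pos: "(\<Sum>a<k. \<Sum>b<k. y a * y b * M a b) > 0" if "\<exists>a<k. y a \<noteq> 0" for y
    unfolding M_def by (rule perturbed_identity_pos[OF T_le _ that]) (auto simp: c_def)
  have symM: "M a b = M b a" for a b by (auto simp: M_def symT)
  obtain L where L: "\<And>a b. a < k \<Longrightarrow> b < k \<Longrightarrow> M a b = (\<Sum>l<k. L l a * L l b)"
  proof -
    have "\<exists>L. \<forall>a<k. \<forall>b<k. M a b = (\<Sum>l<k. L l a * L l b)"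
    proof (rule cholesky)
      show "M a b = M b a" for a b by (rule symM)
    qed (rule pos)
    then show ?thesis using that by blast
  qed
  \<comment> \<open>The matrix \<open>L L\<^sup>T\<close>, whereas \<open>M\<close> is
    \<open>L\<^sup>T L\<close>.\<close>
  define S where "S p q = (\<Sum>a<k. L p a * L q a)" for p q
  have symS: "S p q = S q p" for p q by (simp add: S_def mult.commute)
  have nsS: "\<not> scalar_on k S"
  proof
    assume "scalar_on k S"
    then obtain d where d: "\<And>p q. p < k \<Longrightarrow> q < k \<Longrightarrow> S p q = of_bool (p = q) * d"
      unfolding scalar_on_def by blast
    \<comment> \<open>If \<open>L L\<^sup>T\<close> is \<open>d\<close> times the identity, then
      \<open>L\<^sup>T (L L\<^sup>T) L\<close> gives \<open>M\<^sup>2 = d M\<close>.\<close>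
    have MM: "(\<Sum>b<k. M a b * M b e) = d * M a e" if "a < k" "e < k" for a e
    proof -
      have "(\<Sum>b<k. M a b * M b e) = (\<Sum>b<k. \<Sum>p<k. \<Sum>q<k. L p a * L p b * (L q b * L q e))"
        using L that by (simp add: sum_product)
      also have "\<dots> = (\<Sum>p<k. \<Sum>q<k. \<Sum>b<k. L p a * L p b * (L q b * L q e))"
        by (rule sum_rotate)
      also have "\<dots> = (\<Sum>p<k. \<Sum>q<k. L p a * L q e * S p q)"
        by (simp add: S_def sum_distrib_left mult_ac)
      also have "\<dots> = (\<Sum>p<k. \<Sum>q<k. L p a * d * L q e * of_bool (p = q))"
        using d by (intro sum.cong refl) (simp add: mult_ac)
      also have "\<dots> = (\<Sum>p<k. L p a * d * L p e)"
        by (intro sum.cong refl) (simp add: of_bool_def if_distrib cong: if_cong)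
      also have "\<dots> = d * M a e" using L that by (simp add: sum_distrib_left mult_ac)
      finally show ?thesis .
    qed
    have "M a e = of_bool (a = e) * d" if ae: "a < k" "e < k" for a e
    proof -
      \<comment> \<open>Column \<open>e\<close> of \<open>M - d I\<close>. It is annihilated by the
        positive definite \<open>M\<close>, hence 0; so \<open>M\<close>, and with it
        \<open>T\<close>, would be scalar.\<close>
      define y where "y b = M b e - d * unit e b" for b
      have "(\<Sum>b<k. M a b * y b) = 0" if "a < k" for a
        unfolding y_def right_diff_distrib sum_subtractf MM[OF that ae(2)]
        using sum_unit(1)[OF ae(2), of "\<lambda>b. d * M a b"] by (simp add: mult_ac)
      then have "(\<Sum>a<k. y a * (\<Sum>b<k. M a b * y b)) = 0" by simp
      then have "(\<Sum>a<k. \<Sum>b<k. y a * y b * M a b) = 0"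
        by (simp add: sum_distrib_left mult_ac)
      then have "y a = 0" using pos[of y] ae by (metis less_irrefl)
      then show ?thesis by (simp add: y_def unit_def)
    qed
    then have "T a b = of_bool (a = b) * (c - d)" if "a < k" "b < k" for a b
      using that unfolding M_def by (cases "a = b") (force simp: algebra_simps)+
    then show False using nsT unfolding scalar_on_def by blast
  qed
  \<comment> \<open>The vector \<open>L (x i)\<close>: its squared length is the form of
    \<open>M\<close> at \<open>x i\<close>, and its inner products with rows of the reflection are
    those of \<open>x i\<close> with the new vectors.\<close>
  define y where "y i p = ip k (L p) (x i)" for i p
  have y: "ip k (y i) (y i) \<noteq> 0" if "i \<in> N" for i
  proof -
    have "ip k (y i) (y i) = (\<Sum>p<k. \<Sum>a<k. \<Sum>b<k. L p a * x i a * (L p b * x i b))"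
      by (simp add: ip_def y_def sum_product)
    also have "\<dots> = (\<Sum>a<k. \<Sum>b<k. \<Sum>p<k. L p a * x i a * (L p b * x i b))"
      by (rule sum_rotate)
    also have "\<dots> = (\<Sum>a<k. \<Sum>b<k. x i a * x i b * M a b)"
      using L by (simp add: sum_distrib_left mult_ac)
    also have "\<dots> > 0"
    proof (rule pos)
      have "ip k (x i) (x i) \<noteq> 0" using ip_x[of i i] v[OF that] s[of i] by simp
      then show "\<exists>a<k. x i a \<noteq> 0" unfolding ip_self_eq_0_iff by blast
    qed
    finally show ?thesis by simp
  qed
  txt \<open>The new vectors will be the rows of \<open>U L\<close>, where \<open>U\<close> is the reflection along \<open>w\<close>. They are
    orthogonal neither to the old vectors nor to each other if \<open>w\<close> is a non-zero of every function
    in \<open>F\<close>. The last family needs that \<open>L L\<^sup>T\<close> is not scalar.\<close>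
  define F where "F = insert (\<lambda>w. ip k w w)
    ((\<lambda>(i, j) w. ip k (y i) (reflect k w (unit j))) ` (N \<times> {..<k}) \<union>
     (\<lambda>(i, j) w. bilin k S (reflect k w (unit i)) (reflect k w (unit j))) ` ({..<k} \<times> {..<k} - Id))"
  have "\<exists>w. \<forall>f\<in>F. f w \<noteq> 0"
  proof (rule ex_common_nonzero)
    show "finite F" using N(1) by (simp add: F_def)
    show "line_poly f" if "f \<in> F" for f
      using that unfolding F_def
      by (auto intro!: line_poly_ip line_poly_bilin line_poly_reflect line_poly_const line_poly_coord)
    show "\<exists>w. f w \<noteq> 0" if "f \<in> F" for f
    proof -
      from that consider "f = (\<lambda>w. ip k w w)"
        | i j where "i \<in> N" "j < k" "f = (\<lambda>w. ip k (y i) (reflect k w (unit j)))"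
        | i j where "i < k" "j < k" "i \<noteq> j" "f = (\<lambda>w. bilin k S (reflect k w (unit i)) (reflect k w (unit j)))"
        unfolding F_def by auto
      then show ?thesis
      proof cases
        case 1
        then show ?thesis using k(2) ip_unit(1)[of 0 k "unit 0"] by (intro exI[of _ "unit 0"]) (simp add: unit_def)
      next
        case 2
        then show ?thesis using ex_ip_reflect_nonzero[OF y[OF 2(1)], of "unit j"] ip_unit(1)[of j k "unit j"]
          by (simp add: unit_def)
      next
        case 3
        show ?thesis
        proof (rule ccontr)
          assume "\<nexists>w. f w \<noteq> 0"
          then show False
            using scalar_if_reflect_entry_0[of k S i j] symS 3 nsS unfolding scalar_on_def by simp
        qed
      qed
    qed
  qed
  then obtain w where w: "\<And>f. f \<in> F \<Longrightarrow> f w \<noteq> 0" by blast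
  define \<omega> where "\<omega> = ip k w w"
  have w1: "\<omega> \<noteq> 0" using w[of "\<lambda>w. ip k w w"] by (simp add: F_def \<omega>_def)
  have w2: "ip k (y i) (reflect k w (unit j)) \<noteq> 0" if "i \<in> N" "j < k" for i j
    by (rule w[of "\<lambda>w. ip k (y i) (reflect k w (unit j))"]) (use that in \<open>auto simp: F_def\<close>)
  have w3: "bilin k S (reflect k w (unit i)) (reflect k w (unit j)) \<noteq> 0" if "i < k" "j < k" "i \<noteq> j" for i j
    by (rule w[of "\<lambda>w. bilin k S (reflect k w (unit i)) (reflect k w (unit j))"]) (use that in \<open>auto simp: F_def\<close>)
  obtain g where g: "bij_betw g R {..<k}"
    using ex_bij_betw_finite_nat[OF R(1)] k(1) by (auto simp: atLeast0LessThan)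
  have gk: "g i < k" if "i \<in> R" for i using g that by (auto simp: bij_betw_def)
  \<comment> \<open>Row \<open>j\<close> of the scaled reflection, which is a symmetric matrix with
    square \<open>\<omega>\<^sup>2 I\<close>.\<close>
  define h where "h j = reflect k w (unit j)" for j
  have h_sym: "h j p = h p j" if "j < k" "p < k" for j p
    unfolding h_def reflect_def ip_unit(1)[OF that(1)] ip_unit(1)[OF that(2)] by (auto simp: unit_def)
  have hh: "(\<Sum>j<k. h j p * h j q) = \<omega>\<^sup>2 * of_bool (p = q)" if "p < k" "q < k" for p q
  proof -
    have "(\<Sum>j<k. h j p * h j q) = ip k (h p) (h q)"
      unfolding ip_def using h_sym that by (intro sum.cong) auto
    also have "\<dots> = \<omega>\<^sup>2 * of_bool (p = q)"
      unfolding h_def ip_reflect_reflect ip_unit(1)[OF that(2)] by (auto simp: \<omega>_def unit_def)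
    finally show ?thesis .
  qed
  define r where "r j a = (\<Sum>p<k. h j p * L p a)" for j a
  have rr: "(\<Sum>j<k. r j a * r j b) = \<omega>\<^sup>2 * M a b" if "a < k" "b < k" for a b
  proof -
    have "(\<Sum>j<k. r j a * r j b) = (\<Sum>j<k. \<Sum>p<k. \<Sum>q<k. h j p * L p a * (h j q * L q b))"
      by (simp add: r_def sum_product)
    also have "\<dots> = (\<Sum>p<k. \<Sum>q<k. \<Sum>j<k. h j p * L p a * (h j q * L q b))"
      by (rule sum_rotate)
    also have "\<dots> = (\<Sum>p<k. \<Sum>q<k. L p a * L q b * (\<Sum>j<k. h j p * h j q))"
      by (simp add: sum_distrib_left mult_ac)
    also have "\<dots> = (\<Sum>p<k. \<Sum>q<k. L p a * L q b * \<omega>\<^sup>2 * of_bool (p = q))"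
      using hh by (intro sum.cong refl) simp
    also have "\<dots> = (\<Sum>p<k. L p a * L p b * \<omega>\<^sup>2)"
      by (intro sum.cong refl) (simp add: of_bool_def if_distrib cong: if_cong)
    also have "\<dots> = \<omega>\<^sup>2 * M a b" using L[OF that] by (simp add: sum_distrib_left mult_ac)
    finally show ?thesis .
  qed
  have ip_r: "ip k (r i) (r j) = bilin k S (h i) (h j)" for i j
  proof -
    have "ip k (r i) (r j) = (\<Sum>a<k. \<Sum>p<k. \<Sum>q<k. h i p * L p a * (h j q * L q a))"
      by (simp add: ip_def r_def sum_product)
    also have "\<dots> = (\<Sum>p<k. \<Sum>q<k. \<Sum>a<k. h i p * L p a * (h j q * L q a))"
      by (rule sum_rotate)
    also have "\<dots> = bilin k S (h i) (h j)"
      by (simp add: bilin_def S_def sum_distrib_left sum_distrib_right mult_ac)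
    finally show ?thesis .
  qed
  have ip_xr: "ip k (x i) (r j) = ip k (y i) (h j)" for i j
  proof -
    have "ip k (x i) (r j) = (\<Sum>a<k. \<Sum>p<k. x i a * (h j p * L p a))"
      by (simp add: ip_def r_def sum_distrib_left)
    also have "\<dots> = (\<Sum>p<k. \<Sum>a<k. x i a * (h j p * L p a))" by (rule sum.swap)
    also have "\<dots> = ip k (y i) (h j)"
      by (simp add: ip_def y_def sum_distrib_left sum_distrib_right mult_ac)
    finally show ?thesis .
  qed
  \<comment> \<open>The factor \<open>\<omega>\<close> on the old vectors matches the scaling of the
    reflection, so that the two frame operators add up to a scalar matrix.\<close>
  define u where "u i = (if i \<in> R then r (g i) else (\<lambda>a. \<omega> * x i a))" for i
  have uN: "u i = (\<lambda>a. \<omega> * x i a)" if "i \<in> N" for i using that R(2) by (auto simp: u_def)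
  have uR: "u i = r (g i)" if "i \<in> R" for i using that by (simp add: u_def)
  have ip_scale: "ip k (\<lambda>a. \<omega> * x i a) z = \<omega> * ip k (x i) z" for i z
    by (simp add: ip_def sum_distrib_left mult_ac)
  show ?thesis
  proof (intro exI[of _ u] exI[of _ "\<omega>\<^sup>2 * c"] conjI allI impI ballI)
    fix a b assume ab: "a < k" "b < k"
    have "frame_op (N \<union> R) u a b = (\<Sum>i\<in>N. u i a * u i b) + (\<Sum>i\<in>R. u i a * u i b)"
      unfolding frame_op_def using N R by (intro sum.union_disjoint) auto
    also have "(\<Sum>i\<in>N. u i a * u i b) = \<omega>\<^sup>2 * T a b"
      unfolding T_def frame_op_def sum_distrib_left
      by (intro sum.cong refl) (simp add: uN power2_eq_square)
    also have "(\<Sum>i\<in>R. u i a * u i b) = (\<Sum>i\<in>R. r (g i) a * r (g i) b)"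
      by (intro sum.cong refl) (simp add: uR)
    also have "\<dots> = (\<Sum>j<k. r j a * r j b)" by (rule sum.reindex_bij_betw[OF g])
    finally show "frame_op (N \<union> R) u a b = of_bool (a = b) * (\<omega>\<^sup>2 * c)"
      unfolding rr[OF ab] by (simp add: M_def algebra_simps)
  next
    fix i j assume "i \<in> N" "j \<in> N"
    then show "ip k (u i) (u j) = 0 \<longleftrightarrow> ip k (v i) (v j) = 0"
      using w1 s by (simp add: uN ip_scale ip_x ip_commute[of k "x i" "\<lambda>a. \<omega> * x j a"]
          ip_commute[of k "v j" "v i"])
  next
    fix i j assume ij: "i \<in> N \<union> R" "j \<in> R" "i \<noteq> j"
    show "ip k (u i) (u j) \<noteq> 0"
    proof (cases "i \<in> R")
      case True
      then have "g i \<noteq> g j" using g ij by (auto simp: bij_betw_def inj_on_def)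
      then show ?thesis using True ij gk w3 by (simp add: uR ip_r h_def)
    next
      case False
      then show ?thesis using ij gk w2 w1 by (simp add: uN uR ip_scale ip_xr h_def)
    qed
  qed
qed

section \<open>Components of sparse graphs\<close>

text \<open>Starting from the identity labelling, each edge merges the labels of its two ends and so
  costs at most one label.\<close>

lemma ex_component_labels:
  assumes "finite H" "finite V" "\<And>e. e \<in> H \<Longrightarrow> card e = 2"
  shows "\<exists>f :: 'a \<Rightarrow> 'a. (\<forall>e\<in>H. \<forall>i\<in>e. \<forall>j\<in>e. f i = f j) \<and> card V \<le> card (f ` V) + card H"
  using assms(1,3)
proof (induction H)
  case empty
  then show ?case by (intro exI[of _ id]) auto
next
  case (insert e H)
  then obtain f :: "'a \<Rightarrow> 'a" where f: "\<And>e i j. e \<in> H \<Longrightarrow> i \<in> e \<Longrightarrow> j \<in> e \<Longrightarrow> f i = f j"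
    "card V \<le> card (f ` V) + card H"
    by (metis (no_types, lifting) insertCI insert.IH)
  obtain i j where e: "e = {i, j}" using insert.prems[of e] by (auto simp: card_2_iff)
  define f' where "f' x = (if f x = f i then f j else f x)" for x
  have "f ` V \<subseteq> insert (f i) (f' ` V)" by (auto simp: f'_def)
  then have "card (f ` V) \<le> Suc (card (f' ` V))"
    using assms(2) card_mono[of "insert (f i) (f' ` V)" "f ` V"] card_insert_le_m1
    by (metis (no_types, lifting) card_insert_if finite_imageI finite_insert le_SucI)
  then have "card V \<le> card (f' ` V) + card (insert e H)" using f(2) insert.hyps by simp
  moreover have "\<forall>e\<in>insert e H. \<forall>x\<in>e. \<forall>y\<in>e. f' x = f' y"
  proof (intro ballI)
    fix d x y assume d: "d \<in> insert e H" "x \<in> d" "y \<in> d"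
    show "f' x = f' y"
    proof (cases "d = e")
      case True
      then show ?thesis using d by (auto simp: f'_def e)
    next
      case False
      then have "f x = f y" using f(1)[of d x y] d by simp
      then show ?thesis by (simp add: f'_def)
    qed
  qed
  ultimately show ?case by blast
qed

lemma card_image_fibers_ge_2:
  assumes "finite W" "\<And>i. i \<in> W \<Longrightarrow> card {j \<in> W. f j = f i} \<ge> 2"
  shows "2 * card (f ` W) \<le> card W"
proof -
  have "2 * card (f ` W) = (\<Sum>l\<in>f ` W. 2)" by simp
  also have "\<dots> \<le> (\<Sum>l\<in>f ` W. card {j \<in> W. f j = l})"
    using assms(2) by (intro sum_mono) auto
  also have "\<dots> = card W"
    using sum.group[of W "f ` W" f "\<lambda>_. 1::nat"] assms(1) by simp
  finally show ?thesis .
qed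

text \<open>\<open>R\<close> consists of the singleton fibres. If \<open>C\<close> is another fibre and \<open>W\<close> is the union of the
  remaining ones, then \<open>card (f ` V) \<le> card R + 1 + card W div 2\<close>, and the hypothesis gives
  \<open>card C \<le> card R\<close>. If \<open>f\<close> is injective, one vertex is moved out of \<open>R\<close> to keep \<open>N\<close> non-empty.\<close>

lemma ex_core_partition:
  fixes f :: "'a \<Rightarrow> 'b"
  assumes V: "finite V" "card V \<ge> 3" and c: "card V + 2 \<le> 2 * card (f ` V)"
  shows "\<exists>N R. N \<union> R = V \<and> N \<inter> R = {} \<and> N \<noteq> {} \<and> card R \<ge> 2
    \<and> (\<forall>i\<in>R. \<forall>j\<in>V. f i = f j \<longrightarrow> i = j) \<and> (\<forall>l. card {i \<in> N. f i = l} \<le> card R)"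
proof (cases "inj_on f V")
  case True
  obtain x where x: "x \<in> V" using V by fastforce
  have r: "card (V - {x}) = card V - 1" using x by (simp add: V)
  have "\<forall>l. card {i \<in> {x}. f i = l} \<le> card (V - {x})"
  proof
    fix l
    have "card {i \<in> {x}. f i = l} \<le> card {x}" by (intro card_mono) auto
    also have "\<dots> \<le> card (V - {x})" using r V(2) by simp
    finally show "card {i \<in> {x}. f i = l} \<le> card (V - {x})" .
  qed
  moreover have "{x} \<union> (V - {x}) = V" "{x} \<inter> (V - {x}) = {}" "card (V - {x}) \<ge> 2"
    using x r V(2) by auto
  moreover have "\<forall>i\<in>V - {x}. \<forall>j\<in>V. f i = f j \<longrightarrow> i = j"
    using True by (auto simp: inj_on_def)
  ultimately show ?thesis by blast
next
  case False
  define R where "R = {i \<in> V. \<forall>j\<in>V. f i = f j \<longrightarrow> i = j}"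
  define N where "N = V - R"
  have fin: "finite R" "finite N" using V by (auto simp: R_def N_def)
  have le: "card {j \<in> N. f j = f i} \<le> card R \<and> 2 \<le> card {j \<in> N. f j = f i}" if i: "i \<in> N" for i
  proof -
    define C where "C = {j \<in> N. f j = f i}"
    define W where "W = N - C"
    have fib: "2 \<le> card {j \<in> N. f j = f i}" if i: "i \<in> N" for i
    proof -
      obtain j where j: "j \<in> V" "f j = f i" "j \<noteq> i" using i by (force simp: N_def R_def)
      then have "j \<in> N" using i by (auto simp: N_def R_def)
      then have "{i, j} \<subseteq> {j \<in> N. f j = f i}" using i j by auto
      then have "card {i, j} \<le> card {j \<in> N. f j = f i}" using fin by (intro card_mono) auto
      then show ?thesis using j by simp
    qed
    have "card {j \<in> W. f j = f m} \<ge> 2" if "m \<in> W" for m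
    proof -
      have "{j \<in> W. f j = f m} = {j \<in> N. f j = f m}" using that by (auto simp: W_def C_def)
      then show ?thesis using fib[of m] that by (simp add: W_def)
    qed
    then have W: "2 * card (f ` W) \<le> card W" using fin by (intro card_image_fibers_ge_2) (auto simp: W_def)
    have "V = R \<union> (C \<union> W)" using i by (auto simp: N_def R_def C_def W_def)
    then have "f ` V \<subseteq> f ` R \<union> insert (f i) (f ` W)" by (auto simp: C_def)
    then have "card (f ` V) \<le> card (f ` R \<union> insert (f i) (f ` W))"
      using fin by (intro card_mono) (auto simp: W_def)
    also have "\<dots> \<le> card (f ` R) + card (insert (f i) (f ` W))" by (rule card_Un_le)
    also have "\<dots> \<le> card R + Suc (card (f ` W))"
      using fin by (intro add_mono card_image_le card_insert_le_m1) (auto simp: card_insert_if W_def)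
    finally have 1: "card (f ` V) \<le> card R + Suc (card (f ` W))" .
    have "C \<subseteq> N" by (auto simp: C_def)
    then have "card N = card C + card W"
      unfolding W_def using fin by (metis card_Diff_subset card_mono finite_subset le_add_diff_inverse)
    moreover have "card V = card R + card N"
      unfolding N_def using V card_mono[of V R] by (subst card_Diff_subset) (auto simp: R_def)
    ultimately have "card C \<le> card R" using 1 W c by linarith
    then show ?thesis using fib[OF i] by (simp add: C_def)
  qed
  have "N \<noteq> {}" using False by (auto simp: N_def R_def inj_on_def)
  show ?thesis
  proof (rule exI[of _ N], rule exI[of _ R], intro conjI allI)
    show "card {i \<in> N. f i = l} \<le> card R" for l
    proof (cases "l \<in> f ` N")
      case False
      then have "{i \<in> N. f i = l} = {}" by auto
      then show ?thesis by (metis card.empty le0)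
    qed (use le in auto)
    \<comment> \<open>Some fibre in \<open>N\<close> has at least two elements and at most
      \<open>card R\<close>.\<close>
    show "card R \<ge> 2" using le \<open>N \<noteq> {}\<close> by fastforce
    show "N \<noteq> {}" by fact
  qed (auto simp: N_def R_def)
qed

section \<open>Eigenvalues of symmetric matrices\<close>

text \<open>The Hermitian form \<open>s\<close> at an eigenvector equals its own conjugate, and it
  is \<open>e\<close> times the positive real number \<open>t\<close>.\<close>

lemma eigenvalue_real_symmetric:
  fixes A :: "real mat"
  assumes A: "A \<in> carrier_mat n n" and sym: "transpose_mat A = A"
    and ev: "eigenvalue (map_mat complex_of_real A) e"
  shows "cnj e = e"
proof -
  obtain v where v: "v \<in> carrier_vec n" "v \<noteq> 0\<^sub>v n"
    "map_mat complex_of_real A *\<^sub>v v = e \<cdot>\<^sub>v v"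
    using ev A unfolding eigenvalue_def eigenvector_def by auto
  have symij: "A $$ (i,j) = A $$ (j,i)" if "i < n" "j < n" for i j
    using that A arg_cong[OF sym, of "\<lambda>M. M $$ (j,i)"] by simp
  have row: "(\<Sum>j<n. complex_of_real (A $$ (i,j)) * v $ j) = e * v $ i" if "i < n" for i
    using arg_cong[OF v(3), of "\<lambda>u. u $ i"] that A v(1)
    by (simp add: scalar_prod_def atLeast0LessThan)
  define s where "s = (\<Sum>i<n. \<Sum>j<n. cnj (v $ i) * (complex_of_real (A $$ (i,j)) * v $ j))"
  define t where "t = (\<Sum>i<n. cnj (v $ i) * v $ i)"
  have "s = (\<Sum>i<n. cnj (v $ i) * (e * v $ i))"
    unfolding s_def using row by (simp flip: sum_distrib_left)
  then have s: "s = e * t"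
    unfolding t_def by (simp add: sum_distrib_left mult_ac)
  have "cnj s = (\<Sum>i<n. \<Sum>j<n. cnj (v $ j) * (complex_of_real (A $$ (j,i)) * v $ i))"
    unfolding s_def by (auto intro!: sum.cong simp: symij mult_ac)
  also have "\<dots> = s"
    unfolding s_def by (rule sum.swap)
  finally have cs: "cnj s = s" .
  have t: "t = complex_of_real (\<Sum>i<n. (cmod (v $ i))\<^sup>2)"
    unfolding t_def by (simp add: complex_norm_square mult.commute del: of_real_power)
  obtain i where i: "i < n" "v $ i \<noteq> 0"
    using v(1,2) by (metis carrier_vecD eq_vecI index_zero_vec)
  then have "(\<Sum>i<n. (cmod (v $ i))\<^sup>2) > 0"
    by (intro sum_pos2[of _ i]) auto
  then have "t \<noteq> 0" unfolding t by (metis of_real_eq_0_iff less_irrefl)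
  moreover have "cnj e * t = e * t"
    using cs unfolding s t by simp
  ultimately show ?thesis by simp
qed

lemma sum_diag_mult_commute:
  fixes X Y :: "'a :: comm_ring_1 mat"
  assumes "X \<in> carrier_mat n n" "Y \<in> carrier_mat n n"
  shows "(\<Sum>i<n. (X * Y) $$ (i,i)) = (\<Sum>i<n. (Y * X) $$ (i,i))"
proof -
  have "(\<Sum>i<n. (X * Y) $$ (i,i)) = (\<Sum>i<n. \<Sum>j<n. X $$ (i,j) * Y $$ (j,i))"
    using assms by (auto simp: scalar_prod_def atLeast0LessThan)
  also have "\<dots> = (\<Sum>j<n. \<Sum>i<n. X $$ (i,j) * Y $$ (j,i))" by (rule sum.swap)
  also have "\<dots> = (\<Sum>i<n. (Y * X) $$ (i,i))"
    using assms by (auto simp: scalar_prod_def atLeast0LessThan mult.commute intro!: sum.cong)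
  finally show ?thesis .
qed

lemma symmetric_spectrum_0:
  fixes A :: "real mat"
  assumes A: "A \<in> carrier_mat n n" and sym: "transpose_mat A = A"
    and sp: "spectrum A \<subseteq> {0}"
  shows "A = 0\<^sub>m n n"
proof -
  define C where "C = map_mat complex_of_real A"
  have C: "C \<in> carrier_mat n n" using A by (simp add: C_def)
  obtain es where es: "char_poly C = (\<Prod>a\<leftarrow>es. [:- a, 1:])"
    using char_poly_factorized[OF C] by blast
  obtain B P Q where bpq: "schur_decomposition C es = (B, P, Q)"
    by (cases "schur_decomposition C es") auto
  have sd: "similar_mat_wit C B P Q" "upper_triangular B" "diag_mat B = es"
    using schur_decomposition[OF C es bpq] by auto
  note pq = similar_mat_witD2[OF C sd(1)]
  \<comment> \<open>The diagonal of the Schur form consists of complex eigenvalues, while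
    \<open>spectrum A\<close> holds only real ones; realness has to be shown before the hypothesis
    applies.\<close>
  have es0: "e = 0" if "e \<in> set es" for e
  proof -
    have r: "poly (char_poly C) e = 0"
      unfolding es using that by (induction es) auto
    then have ev: "eigenvalue C e" using eigenvalue_root_char_poly[OF C] by simp
    then have "cnj e = e" using eigenvalue_real_symmetric[OF A sym] by (simp add: C_def)
    then obtain x where x: "e = of_real x" by (metis Reals_cases complex_cnj_cancel_iff Reals_cnj_iff)
    have "poly (char_poly C) (of_real x) = of_real (poly (char_poly A) x)"
      unfolding C_def of_real_hom.char_poly_hom[OF A] by (simp add: of_real_hom.poly_map_poly)
    then have "eigenvalue A x" using r x eigenvalue_root_char_poly[OF A] by simp
    then show ?thesis using sp x by (auto simp: spectrum_def)
  qed
  have B0: "B $$ (i,j) = 0" if "i < n" "j < n" "j \<le> i" for i j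
  proof (cases "i = j")
    case True
    then have "B $$ (i,j) \<in> set (diag_mat B)" using that pq(5) by (auto simp: diag_mat_def)
    then show ?thesis using es0 sd by auto
  qed (use that sd(2) pq(5) in auto)
  have "C * C = P * (B * (B * Q))"
  proof -
    have "C * C = P * (B * ((Q * P) * (B * Q)))"
      unfolding pq(3) using pq(5-7) by (simp add: assoc_mult_mat[of _ n n _ n _ n])
    also have "(Q * P) * (B * Q) = B * Q"
      unfolding pq(2) using pq(5-7) by simp
    finally show ?thesis .
  qed
  then have "(\<Sum>i<n. (C * C) $$ (i,i)) = (\<Sum>i<n. ((B * (B * Q)) * P) $$ (i,i))"
    using pq(5-7) sum_diag_mult_commute[of P n "B * (B * Q)"] by simp
  also have "(B * (B * Q)) * P = B * (B * (Q * P))"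
    using pq(5-7) by (simp add: assoc_mult_mat[of _ n n _ n _ n])
  also have "\<dots> = B * B"
    unfolding pq(2) using pq(5) by simp
  also have "(\<Sum>i<n. (B * B) $$ (i,i)) = (\<Sum>i<n. \<Sum>j<n. B $$ (i,j) * B $$ (j,i))"
    using pq by (auto simp: scalar_prod_def atLeast0LessThan)
  also have "\<dots> = 0"
    \<comment> \<open>In every product one of the two factors lies on or below the diagonal.\<close>
    using B0 by (intro sum.neutral ballI) (metis lessThan_iff mult_eq_0_iff nle_le)
  finally have "(\<Sum>i<n. (C * C) $$ (i,i)) = 0" .
  moreover have symij: "A $$ (i,j) = A $$ (j,i)" if "i < n" "j < n" for i j
    using that A arg_cong[OF sym, of "\<lambda>M. M $$ (j,i)"] by simp
  then have "(\<Sum>i<n. (C * C) $$ (i,i)) = (\<Sum>i<n. \<Sum>j<n. of_real (A $$ (i,j) * A $$ (i,j)))"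
    using A by (auto simp: scalar_prod_def atLeast0LessThan C_def symij intro!: sum.cong)
  ultimately have "(\<Sum>i<n. \<Sum>j<n. A $$ (i,j) * A $$ (i,j)) = 0"
    by (simp flip: of_real_sum of_real_mult)
  then have "A $$ (i,j) = 0" if "i < n" "j < n" for i j
    using that by (simp add: sum_nonneg_eq_0_iff sum_nonneg)
  then show ?thesis using A by (intro eq_matI) auto
qed

lemma symmetric_two_eigenvalues:
  fixes A :: "real mat"
  assumes A: "A \<in> carrier_mat n n" and sym: "transpose_mat A = A"
    and ij: "i < n" "j < n" "i \<noteq> j" "A $$ (i,j) \<noteq> 0"
  shows "card (spectrum A) \<ge> 2"
proof (rule ccontr)
  assume "\<not> ?thesis"
  \<comment> \<open>As the spectrum is finite, cardinality 0 means that it is empty, and then any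
    \<open>c\<close> serves.\<close>
  then have "card (spectrum A) = 0 \<or> card (spectrum A) = 1" by auto
  then obtain c where c: "spectrum A \<subseteq> {c}"
    using card_finite_spectrum(1)[OF A] by (auto simp: card_1_singleton_iff)
  define N where "N = A - c \<cdot>\<^sub>m 1\<^sub>m n"
  have N: "N \<in> carrier_mat n n" using A unfolding N_def by (intro minus_carrier_mat) simp
  have "transpose_mat N = N"
  proof (rule eq_matI)
    show "transpose_mat N $$ (i,j) = N $$ (i,j)" if "i < dim_row N" "j < dim_col N" for i j
      using that A arg_cong[OF sym, of "\<lambda>M. M $$ (i,j)"] by (auto simp: N_def)
  qed (use N in auto)
  moreover have "spectrum N \<subseteq> {0}"
  proof
    fix x assume "x \<in> spectrum N"
    then obtain v where v: "v \<in> carrier_vec n" "v \<noteq> 0\<^sub>v n" "N *\<^sub>v v = x \<cdot>\<^sub>v v"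
      using N unfolding spectrum_def eigenvalue_def eigenvector_def by auto
    have "A *\<^sub>v v = (x + c) \<cdot>\<^sub>v v"
    proof -
      have "A = N + c \<cdot>\<^sub>m 1\<^sub>m n" using A by (intro eq_matI) (auto simp: N_def)
      then have "A *\<^sub>v v = N *\<^sub>v v + (c \<cdot>\<^sub>m 1\<^sub>m n) *\<^sub>v v"
        using N v(1) by (simp add: add_mult_distrib_mat_vec[of _ n n])
      also have "(c \<cdot>\<^sub>m 1\<^sub>m n) *\<^sub>v v = c \<cdot>\<^sub>v v"
        using v(1) by (intro eq_vecI) (auto simp: scalar_prod_def if_distrib if_distribR cong: if_cong)
      finally show ?thesis using v by (simp add: add_smult_distrib_vec)
    qed
    then have "x + c \<in> spectrum A"
      using v A unfolding spectrum_def eigenvalue_def eigenvector_def by auto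
    then show "x \<in> {0}" using c by auto
  qed
  ultimately have "N = 0\<^sub>m n n" using symmetric_spectrum_0[OF N] by simp
  then have "N $$ (i,j) = 0" using ij by simp
  then show False using ij A by (simp add: N_def)
qed

lemma spectrum_subset_if_square_eq_smult:
  fixes A :: "real mat"
  assumes A: "A \<in> carrier_mat n n" and AA: "A * A = c \<cdot>\<^sub>m A"
  shows "spectrum A \<subseteq> {0, c}"
proof
  fix x assume "x \<in> spectrum A"
  then obtain v where v: "v \<in> carrier_vec n" "v \<noteq> 0\<^sub>v n" "A *\<^sub>v v = x \<cdot>\<^sub>v v"
    using A unfolding spectrum_def eigenvalue_def eigenvector_def by auto
  have "x \<cdot>\<^sub>v (x \<cdot>\<^sub>v v) = A *\<^sub>v (A *\<^sub>v v)"
    using A v by (simp add: mult_mat_vec)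
  also have "\<dots> = (A * A) *\<^sub>v v" using A v(1) by simp
  also have "\<dots> = c \<cdot>\<^sub>v (A *\<^sub>v v)"
    unfolding AA using A v(1) by (intro eq_vecI) (auto simp: scalar_prod_def sum_distrib_left mult_ac)
  finally have eq: "x \<cdot>\<^sub>v (x \<cdot>\<^sub>v v) = c \<cdot>\<^sub>v (x \<cdot>\<^sub>v v)" using v(3) by simp
  obtain i where i: "i < n" "v $ i \<noteq> 0"
    using v(1,2) by (metis carrier_vecD eq_vecI index_zero_vec)
  have "x * (x * v $ i) = c * (x * v $ i)"
    using arg_cong[OF eq, of "\<lambda>u. u $ i"] i v(1) by simp
  then show "x \<in> {0, c}" using i by auto
qed

section \<open>Two distinct eigenvalues\<close>

text \<open>With the vectors as rows of \<open>V\<close>, this is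
  \<open>V (V\<^sup>T V) V\<^sup>T = c V V\<^sup>T\<close>.\<close>

lemma gram_square:
  assumes "\<forall>a<k. \<forall>b<k. frame_op {..<n} u a b = of_bool (a = b) * c"
  shows "(\<Sum>l<n. ip k (u i) (u l) * ip k (u l) (u j)) = c * ip k (u i) (u j)"
proof -
  have "(\<Sum>l<n. ip k (u i) (u l) * ip k (u l) (u j))
      = (\<Sum>l<n. \<Sum>a<k. \<Sum>b<k. u i a * u l a * (u l b * u j b))"
    by (simp add: ip_def sum_product)
  also have "\<dots> = (\<Sum>a<k. \<Sum>b<k. \<Sum>l<n. u i a * u l a * (u l b * u j b))"
    by (rule sum_rotate)
  also have "\<dots> = (\<Sum>a<k. \<Sum>b<k. u i a * u j b * frame_op {..<n} u a b)"
    by (simp add: frame_op_def sum_distrib_left mult_ac)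
  also have "\<dots> = (\<Sum>a<k. \<Sum>b<k. c * u i a * u j b * of_bool (a = b))"
    using assms by (intro sum.cong refl) simp
  also have "\<dots> = (\<Sum>a<k. c * u i a * u j a)"
    by (intro sum.cong refl) (simp add: of_bool_def if_distrib cong: if_cong)
  finally show ?thesis by (simp add: ip_def sum_distrib_left mult_ac)
qed

theorem theorem2p3:
  fixes n :: nat and E :: "nat set set"
  assumes "n \<ge> 3"
    and "simple_graph n E"
    and "card (complement_edges n E) \<le> n div 2 - 1"
  shows "q n E = 2"
proof -
  define H where "H = complement_edges n E"
  have H2: "card e = 2" if "e \<in> H" for e
    using that by (auto simp: H_def complement_edges_def all_edges_def)
  have "H \<subseteq> Pow {..<n}" by (auto simp: H_def complement_edges_def all_edges_def)
  then have finH: "finite H" by (rule finite_subset) simp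
  obtain f :: "nat \<Rightarrow> nat" where f: "\<forall>e\<in>H. \<forall>i\<in>e. \<forall>j\<in>e. f i = f j"
    and cardf: "card {..<n} \<le> card (f ` {..<n}) + card H"
    using ex_component_labels[OF finH, of "{..<n}"] H2 by auto
  \<comment> \<open>Twice the number of edges of \<open>H\<close> is at most \<open>n - 2\<close>,
    the truncated subtraction being harmless for \<open>n\<close> at least 3; there are at least
    \<open>n - card H\<close> labels.\<close>
  have "card {..<n} + 2 \<le> 2 * card (f ` {..<n})"
    using cardf assms(1,3) unfolding H_def by simp
  then obtain N R where V: "N \<union> R = {..<n}" and disj: "N \<inter> R = {}" and N0: "N \<noteq> {}"
    and R2: "card R \<ge> 2" and Rf: "\<forall>i\<in>R. \<forall>j\<in>{..<n}. f i = f j \<longrightarrow> i = j"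
    and size: "\<forall>l. card {i \<in> N. f i = l} \<le> card R"
    using ex_core_partition[of "{..<n}" f] assms(1) by auto
  define k where "k = card R"
  have fin: "finite N" "finite R" using V by (metis finite_Un finite_lessThan)+
  have "\<exists>v. \<forall>i\<in>{i \<in> N. f i \<in> f ` N}. \<forall>j\<in>{i \<in> N. f i \<in> f ` N}. ip k (v i) (v j) = 0 \<longleftrightarrow> {i, j} \<in> H"
  proof (rule ex_faithful_vectors)
    show "{i, j} \<in> H \<longleftrightarrow> {j, i} \<in> H" for i j by (simp add: insert_commute)
    show "{i, i} \<notin> H" for i using H2[of "{i, i}"] by auto
    show "f i = f j" if "{i, j} \<in> H" for i j using f that by blast
    show "card {i \<in> N. f i = l} \<le> k" for l using size by (simp add: k_def)
  qed (use fin R2 in \<open>auto simp: k_def\<close>)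
  then obtain v where v: "\<And>i j. i \<in> N \<Longrightarrow> j \<in> N \<Longrightarrow> ip k (v i) (v j) = 0 \<longleftrightarrow> {i, j} \<in> H"
    by auto
  have "ip k (v i) (v i) \<noteq> 0" if "i \<in> N" for i using v[OF that that] H2[of "{i, i}"] by auto
  then obtain u c where tight: "\<forall>a<k. \<forall>b<k. frame_op (N \<union> R) u a b = of_bool (a = b) * c"
    and uN: "\<And>i j. i \<in> N \<Longrightarrow> j \<in> N \<Longrightarrow> ip k (u i) (u j) = 0 \<longleftrightarrow> ip k (v i) (v j) = 0"
    and uR: "\<And>i j. i \<in> N \<union> R \<Longrightarrow> j \<in> R \<Longrightarrow> i \<noteq> j \<Longrightarrow> ip k (u i) (u j) \<noteq> 0"
    using tight_frame_extension[OF fin(1) N0 fin(2) disj k_def, of v] R2 unfolding k_def by metis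
  \<comment> \<open>Labels agree along edges of \<open>H\<close>, so a vertex with a label of its
    own is isolated there.\<close>
  have HR: "{i, j} \<notin> H" if "i \<in> R" "j < n" "i \<noteq> j" for i j
    using f Rf that by blast
  have E_iff: "{i, j} \<in> E \<longleftrightarrow> {i, j} \<notin> H" if "i < n" "j < n" "i \<noteq> j" for i j
    using that by (auto simp: H_def complement_edges_def all_edges_def)
  define A where "A = mat n n (\<lambda>(i, j). ip k (u i) (u j))"
  have A: "A \<in> carrier_mat n n" by (simp add: A_def)
  have "ip k (u i) (u j) \<noteq> 0 \<longleftrightarrow> {i, j} \<in> E" if ij: "i < n" "j < n" "i \<noteq> j" for i j
  proof -
    have mem: "i \<in> N \<union> R" "j \<in> N \<union> R" using V ij by auto
    consider "i \<in> N" "j \<in> N" | "j \<in> R" | "i \<in> R" using mem by blast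
    then show ?thesis
    proof cases
      case 1 then show ?thesis using uN v E_iff[OF ij] by simp
    next
      case 2 then show ?thesis
        using uR[OF mem(1) 2 ij(3)] HR[of j i] E_iff[OF ij] ij by (simp add: insert_commute)
    next
      case 3 then show ?thesis
        using uR[OF mem(2) 3] HR[of i j] E_iff[OF ij] ij by (simp add: ip_commute[of k "u i"])
    qed
  qed
  then have A_mem: "A \<in> sym_matrices n E"
    unfolding sym_matrices_def by (auto simp: A_def ip_commute intro!: eq_matI)
  have "A * A = c \<cdot>\<^sub>m A"
    using gram_square[of k n u c] tight unfolding V
    by (intro eq_matI) (auto simp: A_def scalar_prod_def atLeast0LessThan)
  then have "spectrum A \<subseteq> {0, c}" by (rule spectrum_subset_if_square_eq_smult[OF A])
  then have "card (spectrum A) \<le> card {0, c}" by (intro card_mono) auto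
  also have "\<dots> \<le> 2" by (simp add: card_insert_if)
  finally have le2: "card (spectrum A) \<le> 2" .
  \<comment> \<open>Two vertices isolated in \<open>H\<close> are adjacent in the graph, which
    forces a non-zero off-diagonal entry in every admissible matrix.\<close>
  obtain i j where ij: "i \<in> R" "j \<in> R" "i \<noteq> j"
    using R2 by (metis card_2_iff' obtain_subset_with_card_n subsetD)
  then have ijn: "i < n" "j < n" using V by auto
  have edge: "{i, j} \<in> E" using HR[of i j] E_iff[of i j] ij ijn by simp
  have ge2: "num_eigenvalues B \<ge> 2" if "B \<in> sym_matrices n E" for B
    using that edge ij ijn symmetric_two_eigenvalues[of B n i j]
    by (simp add: sym_matrices_def num_eigenvalues_def)
  show ?thesis
    unfolding q_def
  proof (rule Least_equality)
    show "\<exists>B\<in>sym_matrices n E. num_eigenvalues B = 2"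
      using A_mem le2 ge2[OF A_mem] by (auto simp: num_eigenvalues_def)
  qed (use ge2 in blast)
qed

end
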